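(* Let $P$ be irreducible. When $\kappa=\kappa^B$ is given by $$\kappa^B(x,A,\tilde x)=\kappa^B(A,\tilde x)=\frac{\pi(\tilde x)\mathcal Q(\tilde x,A)}{\sum_{z\in A}\pi(z)\mathcal Q(z,A)}$$ (Boltzmann or Barker case), then for every real function $f$ on $E$ we have $\sigma(f,f)^2\le\sigma(f)^2$. Furthermore, for $f$ non constant, the function $b\mapsto\sigma(f,bf)^2$ (on $\mathbb R$) is minimal at $$b_\star=\frac{\langle\pi,f^2\rangle-\langle\pi,f\rangle^2}{\langle\pi,f^2-fPf\rangle},$$ and $b_\star>1$ when $\sigma(f,f)^2>0$.
   Context: Let $E$ be a finite set, $\pi$ a probability measure on $E$ with $\pi(x)>0$ for all $x\in E$, $\langle\pi,h\rangle=\sum_{x}\pi(x)h(x)$, and $\mathcal P(E)$ the set of subsets of $E$. Proposition kernel: $\mathcal Q:E\times\mathcal P(E)\to[0,1]$ with, for all $x\in E$, $\mathcal Q(x,A)=0$ if $x\notin A$ and $\sum_{A\in\mathcal P(E)}\mathcal Q(x,A)=1$. A selection probability $\kappa$ gives, for $x\in A\subset E$, a probability $\kappa(x,A,\cdot)$ on $A$ satisfying $\pi(x)\mathcal Q(x,A)\kappa(x,A,\tilde x)=\pi(\tilde x)\mathcal Q(\tilde x,A)\kappa(\tilde x,A,x)$ for all $x,\tilde x\in A$; $\kappa^B$ satisfies this. (For nonempty sets $A$ with $\sum_{z\in A}\pi(z)\mathcal Q(z,A)=0$, which are never proposed, $\kappa^B(A,\cdot)$ is taken uniform on $A$.) Markov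 chain: given the past up to step $n$, the proposal set $A_{n+1}$ is distributed according to $\mathcal Q(X_n,\cdot)$, then $X_{n+1}$ is distributed according to $\kappa(X_n,A_{n+1},\cdot)$. The transition matrix is $P(x,y)=\sum_{A:\,x,y\in A}\mathcal Q(x,A)\kappa(x,A,y)$, reversible with respect to $\pi$. Write $Ph(x)=\sum_yP(x,y)h(y)$. For $f:E\to\mathbb R$, let $F$ be the solution (unique up to an additive constant) of the Poisson equation $F-PF=f-\langle\pi,f\rangle$ and $\sigma(f)^2=\langle\pi,F^2\rangle-\langle\pi,(PF)^2\rangle$, the asymptotic variance of $I_n(f)=\frac1n\sum_{k=1}^nf(X_k)$. For $\psi:E\to\mathbb R$, $\sigma(f,\psi)^2$ is the asymptotic variance of $$I_n(f)+\frac1n\sum_{k=0}^{n-1}\Big(\sum_{\tilde x\in A_{k+1}}\kappa(X_k,A_{k+1},\tilde x)\psi(\tilde x)-\psi(X_{k+1})\Big),$$ given by $$\sigma(f,\psi)^2=\sigma(f)^2+\sum_{x\in E,\,A\in\mathcal P(E)}\pi(x)\mathcal Q(x,A)\big[\mathrm{Var}_{\kappa_{x,A}}(\psi-F)-\mathrm{Var}_{\kappa_{x,A}}(F)\big],$$ with $\mathrm{Var}_{\kappa_{x,A}}(g)=\sum_{y\in A}\kappa(x,A,y)g(y)^2-\big(\sum_{y\in A}\kappa(x,A,y)g(y)\big)^2$. *)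

theory Defs
  imports Complex_Main
begin

text \<open>
  The finite set \<open>E\<close> is the universe of a type of class \<open>finite\<close>. Measures and kernels on \<open>E\<close>
  are given by their real-valued weights.
\<close>

definition prob_weights :: "('a::finite \<Rightarrow> real) \<Rightarrow> bool" where
  "prob_weights \<pi> \<longleftrightarrow> (\<forall>x. 0 \<le> \<pi> x) \<and> (\<Sum>x\<in>UNIV. \<pi> x) = 1"

definition mean :: "('a::finite \<Rightarrow> real) \<Rightarrow> ('a \<Rightarrow> real) \<Rightarrow> real" where
  "mean \<pi> h = (\<Sum>x\<in>UNIV. \<pi> x * h x)"

definition proposal_kernel :: "('a::finite \<Rightarrow> 'a set \<Rightarrow> real) \<Rightarrow> bool" where
  "proposal_kernel Q \<longleftrightarrow>
     (\<forall>x A. 0 \<le> Q x A \<and> Q x A \<le> 1) \<and>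
     (\<forall>x A. x \<notin> A \<longrightarrow> Q x A = 0) \<and>
     (\<forall>x. (\<Sum>A\<in>UNIV. Q x A) = 1)"

text \<open>
  Boltzmann (Barker) selection \<open>\<kappa>\<^sup>B(A, y)\<close>, meaningful for \<open>y \<in> A\<close>. On a set \<open>A\<close> that is never
  proposed, the quotient would be \<open>0 / 0\<close> and the uniform law on \<open>A\<close> is taken instead.
\<close>

definition barker :: "('a::finite \<Rightarrow> real) \<Rightarrow> ('a \<Rightarrow> 'a set \<Rightarrow> real) \<Rightarrow> 'a set \<Rightarrow> 'a \<Rightarrow> real" where
  "barker \<pi> Q A y =
     (if (\<Sum>z\<in>A. \<pi> z * Q z A) = 0 then 1 / real (card A)
      else \<pi> y * Q y A / (\<Sum>z\<in>A. \<pi> z * Q z A))"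

definition transition ::
  "('a::finite \<Rightarrow> 'a set \<Rightarrow> real) \<Rightarrow> ('a \<Rightarrow> 'a set \<Rightarrow> 'a \<Rightarrow> real) \<Rightarrow> 'a \<Rightarrow> 'a \<Rightarrow> real" where
  "transition Q \<kappa> x y = (\<Sum>A\<in>{A. x \<in> A \<and> y \<in> A}. Q x A * \<kappa> x A y)"

definition mat_app :: "('a::finite \<Rightarrow> 'a \<Rightarrow> real) \<Rightarrow> ('a \<Rightarrow> real) \<Rightarrow> 'a \<Rightarrow> real" where
  "mat_app P h x = (\<Sum>y\<in>UNIV. P x y * h y)"

primrec mat_pow :: "('a::finite \<Rightarrow> 'a \<Rightarrow> real) \<Rightarrow> nat \<Rightarrow> 'a \<Rightarrow> 'a \<Rightarrow> real" where
  "mat_pow P 0 x y = (if x = y then 1 else 0)"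
| "mat_pow P (Suc n) x y = (\<Sum>z\<in>UNIV. P x z * mat_pow P n z y)"

definition irreducible_matrix :: "('a::finite \<Rightarrow> 'a \<Rightarrow> real) \<Rightarrow> bool" where
  "irreducible_matrix P \<longleftrightarrow> (\<forall>x y. \<exists>n\<ge>1. mat_pow P n x y > 0)"

definition poisson_equation ::
  "('a::finite \<Rightarrow> real) \<Rightarrow> ('a \<Rightarrow> 'a \<Rightarrow> real) \<Rightarrow> ('a \<Rightarrow> real) \<Rightarrow> ('a \<Rightarrow> real) \<Rightarrow> bool" where
  "poisson_equation \<pi> P f F \<longleftrightarrow> (\<forall>x. F x - mat_app P F x = f x - mean \<pi> f)"

text \<open>
  For an irreducible stochastic matrix with invariant law \<open>\<pi>\<close>, a solution exists and is unique up
  to an additive constant; the variances below do not depend on the constant.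
\<close>

definition poisson_solution ::
  "('a::finite \<Rightarrow> real) \<Rightarrow> ('a \<Rightarrow> 'a \<Rightarrow> real) \<Rightarrow> ('a \<Rightarrow> real) \<Rightarrow> 'a \<Rightarrow> real" where
  "poisson_solution \<pi> P f = (SOME F. poisson_equation \<pi> P f F)"

text \<open>The asymptotic variance \<open>\<sigma>(f)\<^sup>2\<close> of the ergodic mean of \<open>f\<close>.\<close>

definition asymp_var ::
  "('a::finite \<Rightarrow> real) \<Rightarrow> ('a \<Rightarrow> 'a \<Rightarrow> real) \<Rightarrow> ('a \<Rightarrow> real) \<Rightarrow> real" where
  "asymp_var \<pi> P f =
     (let F = poisson_solution \<pi> P f
      in mean \<pi> (\<lambda>x. (F x)^2) - mean \<pi> (\<lambda>x. (mat_app P F x)^2))"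

definition var_on :: "'a::finite set \<Rightarrow> ('a \<Rightarrow> real) \<Rightarrow> ('a \<Rightarrow> real) \<Rightarrow> real" where
  "var_on A k g = (\<Sum>y\<in>A. k y * (g y)^2) - (\<Sum>y\<in>A. k y * g y)^2"

text \<open>
  The asymptotic variance \<open>\<sigma>(f, \<psi>)\<^sup>2\<close> of the ergodic mean of \<open>f\<close> with control variate \<open>\<psi>\<close>.
  Here \<open>F\<close> solves the Poisson equation for \<open>f\<close>, whatever \<open>\<psi>\<close> is.
\<close>

definition asymp_var_control ::
  "('a::finite \<Rightarrow> real) \<Rightarrow> ('a \<Rightarrow> 'a set \<Rightarrow> real) \<Rightarrow> ('a \<Rightarrow> 'a set \<Rightarrow> 'a \<Rightarrow> real) \<Rightarrow>
   ('a \<Rightarrow> real) \<Rightarrow> ('a \<Rightarrow> real) \<Rightarrow> real" where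
  "asymp_var_control \<pi> Q \<kappa> f \<psi> =
     (let P = transition Q \<kappa>; F = poisson_solution \<pi> P f
      in asymp_var \<pi> P f +
         (\<Sum>x\<in>UNIV. \<Sum>A\<in>UNIV. \<pi> x * Q x A *
            (var_on A (\<kappa> x A) (\<lambda>y. \<psi> y - F y) - var_on A (\<kappa> x A) F)))"

end

theory Submission
  imports Defs "HOL-Analysis.Analysis"
begin

text \<open>
  Let \<open>D(g, h) = \<langle>\<pi>, g (h - Ph)\<rangle>\<close> be the Dirichlet form. For Barker's selection the law
  \<open>\<kappa>(x, A, \<cdot>)\<close> does not depend on \<open>x\<close>, so averaging \<open>Var\<^sub>A(g)\<close> over the proposals gives exactly
  \<open>D(g, g)\<close>, and \<open>\<langle>\<pi>, g Pg\<rangle>\<close> is a sum of squares over the sets \<open>A\<close>. As \<open>D(\<psi>, F) = Cov(\<psi>, f)\<close>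
  by the Poisson equation, \<open>\<sigma>(f, \<psi>)\<^sup>2 = \<sigma>(f)\<^sup>2 + D(\<psi>, \<psi>) - 2 Cov(\<psi>, f)\<close>. With \<open>\<psi> = b f\<close> this is
  a quadratic polynomial in \<open>b\<close>, minimal at \<open>Var(f) / D(f, f)\<close>, and \<open>D(f, f) \<le> Var(f)\<close> because \<open>P\<close> is
  positive semidefinite. If \<open>D(f, f) = Var(f)\<close>, then \<open>P\<close> annihilates the centred \<open>f\<close>, so \<open>F\<close> is
  \<open>f\<close> up to a constant and \<open>\<sigma>(f)\<^sup>2 = Var(f)\<close>, whence \<open>\<sigma>(f, f)\<^sup>2 = 0\<close>.
\<close>

section \<open>Linearity of means and kernels, and propagation along paths\<close>

lemma mean_add: "mean \<pi> (\<lambda>x. g x + h x) = mean \<pi> g + mean \<pi> h"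
  by (simp add: mean_def algebra_simps sum.distrib)

lemma mean_diff: "mean \<pi> (\<lambda>x. g x - h x) = mean \<pi> g - mean \<pi> h"
  by (simp add: mean_def algebra_simps sum_subtractf)

lemma mean_cmult: "mean \<pi> (\<lambda>x. c * g x) = c * mean \<pi> g"
  by (simp add: mean_def sum_distrib_left algebra_simps)

lemma mat_app_add: "mat_app P (\<lambda>x. g x + h x) x = mat_app P g x + mat_app P h x"
  by (simp add: mat_app_def algebra_simps sum.distrib)

lemma mat_app_diff: "mat_app P (\<lambda>x. g x - h x) x = mat_app P g x - mat_app P h x"
  by (simp add: mat_app_def algebra_simps sum_subtractf)

lemma mat_app_cmult: "mat_app P (\<lambda>x. c * g x) x = c * mat_app P g x"
  by (simp add: mat_app_def sum_distrib_left algebra_simps)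

text \<open>A positive entry of a power yields a path of positive transitions, and \<open>h\<close>
  is unchanged at each of its steps. This is how irreducibility turns local equality into
  constancy.\<close>

lemma mat_pow_pos_imp_eq:
  assumes "\<And>x y. 0 \<le> P x y" and eq: "\<And>x y. P x y > 0 \<Longrightarrow> h x = h y"
    and "mat_pow P n x y > 0"
  shows "h x = h y"
  using assms(3)
proof (induction n arbitrary: x)
  case 0
  then show ?case by (simp split: if_splits)
next
  case (Suc n)
  then have "\<not> (\<Sum>z\<in>UNIV. P x z * mat_pow P n z y) \<le> 0" by simp
  then obtain z where "P x z * mat_pow P n z y > 0"
    using sum_nonpos[of UNIV "\<lambda>z. P x z * mat_pow P n z y"] not_less by blast
  then have "P x z > 0" "mat_pow P n z y > 0"
    using assms(1)[of x z] by (auto simp: zero_less_mult_iff)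
  then show ?case using eq[of x z] Suc.IH[of z] by simp
qed

section \<open>Dirichlet form of an irreducible reversible chain\<close>

locale reversible_chain =
  fixes \<pi> :: "'a::finite \<Rightarrow> real" and P :: "'a \<Rightarrow> 'a \<Rightarrow> real"
  assumes weight_pos: "\<pi> x > 0"
    and weight_sum: "(\<Sum>x\<in>UNIV. \<pi> x) = 1"
    and P_nonneg: "0 \<le> P x y"
    and P_row_sum: "(\<Sum>y\<in>UNIV. P x y) = 1"
    and reversible: "\<pi> x * P x y = \<pi> y * P y x"
    and irreducible: "irreducible_matrix P"
begin

definition dirichlet :: "('a \<Rightarrow> real) \<Rightarrow> ('a \<Rightarrow> real) \<Rightarrow> real" where
  "dirichlet g h = mean \<pi> (\<lambda>x. g x * (h x - mat_app P h x))"

definition covar :: "('a \<Rightarrow> real) \<Rightarrow> ('a \<Rightarrow> real) \<Rightarrow> real" where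
  "covar g h = mean \<pi> (\<lambda>x. g x * h x) - mean \<pi> g * mean \<pi> h"

lemma mean_const: "mean \<pi> (\<lambda>x. c) = c"
  using weight_sum by (simp add: mean_def flip: sum_distrib_right)

lemma mat_app_const: "mat_app P (\<lambda>x. c) x = c"
  using P_row_sum by (simp add: mat_app_def flip: sum_distrib_right)

text \<open>Detailed balance makes the weight \<open>\<pi> x * P x y\<close> symmetric, so swapping
  the two sums exchanges \<open>g\<close> and \<open>h\<close>. With \<open>g = 1\<close> this gives
  invariance of \<open>\<pi>\<close>.\<close>

lemma mean_mat_app_sym: "mean \<pi> (\<lambda>x. g x * mat_app P h x) = mean \<pi> (\<lambda>x. h x * mat_app P g x)"
proof -
  have "mean \<pi> (\<lambda>x. g x * mat_app P h x) = (\<Sum>x\<in>UNIV. \<Sum>y\<in>UNIV. (\<pi> x * P x y) * (g x * h y))"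
    by (simp add: mean_def mat_app_def sum_distrib_left algebra_simps)
  also have "\<dots> = (\<Sum>y\<in>UNIV. \<Sum>x\<in>UNIV. (\<pi> y * P y x) * (g x * h y))"
    by (subst sum.swap, subst reversible) simp
  also have "\<dots> = mean \<pi> (\<lambda>x. h x * mat_app P g x)"
    by (simp add: mean_def mat_app_def sum_distrib_left algebra_simps)
  finally show ?thesis .
qed

lemma mean_mat_app: "mean \<pi> (mat_app P h) = mean \<pi> h"
  using mean_mat_app_sym[of "\<lambda>x. 1" h] by (simp add: mat_app_const)

lemma dirichlet_eq: "dirichlet g h = mean \<pi> (\<lambda>x. g x * h x) - mean \<pi> (\<lambda>x. g x * mat_app P h x)"
  by (simp add: dirichlet_def right_diff_distrib mean_diff)

lemma dirichlet_sym: "dirichlet g h = dirichlet h g"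
  using mean_mat_app_sym[of g h] by (simp add: dirichlet_eq mult.commute)

lemma dirichlet_cmult: "dirichlet (\<lambda>x. c * g x) (\<lambda>x. c * g x) = c\<^sup>2 * dirichlet g g"
proof -
  have "dirichlet (\<lambda>x. c * g x) (\<lambda>x. c * g x)
      = mean \<pi> (\<lambda>x. c\<^sup>2 * (g x * (g x - mat_app P g x)))"
    by (simp add: dirichlet_def mat_app_cmult power2_eq_square algebra_simps)
  then show ?thesis by (simp only: mean_cmult dirichlet_def)
qed

text \<open>In one slot \<open>P\<close> fixes constants; in the other \<open>g - Pg\<close> has
  mean zero by invariance.\<close>

lemma dirichlet_diff_const: "dirichlet (\<lambda>x. g x - c) (\<lambda>x. g x - c) = dirichlet g g"
proof -
  have "dirichlet (\<lambda>x. g x - c) (\<lambda>x. g x - c)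
      = mean \<pi> (\<lambda>x. g x * (g x - mat_app P g x) - c * (g x - mat_app P g x))"
    by (simp add: dirichlet_def mat_app_diff mat_app_const algebra_simps)
  also have "\<dots> = dirichlet g g"
    by (simp only: mean_diff mean_cmult mean_mat_app dirichlet_def) simp
  finally show ?thesis .
qed

lemma dirichlet_diff:
  "dirichlet (\<lambda>x. g x - h x) (\<lambda>x. g x - h x) = dirichlet g g - 2 * dirichlet g h + dirichlet h h"
proof -
  have "dirichlet (\<lambda>x. g x - h x) (\<lambda>x. g x - h x)
      = mean \<pi> (\<lambda>x. g x * (g x - mat_app P g x) - g x * (h x - mat_app P h x)
          - h x * (g x - mat_app P g x) + h x * (h x - mat_app P h x))"
    by (simp add: dirichlet_def mat_app_diff algebra_simps)
  also have "\<dots> = dirichlet g g - dirichlet g h - dirichlet h g + dirichlet h h"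
    by (simp only: mean_add mean_diff dirichlet_def)
  finally show ?thesis using dirichlet_sym[of h g] by simp
qed

text \<open>Expanding the square, row sums handle \<open>(h x)^2\<close> and invariance handles
  \<open>(h y)^2\<close>. This form shows both the sign and the null space.\<close>

lemma dirichlet_self:
  "2 * dirichlet h h = (\<Sum>x\<in>UNIV. \<Sum>y\<in>UNIV. \<pi> x * P x y * (h x - h y)\<^sup>2)"
proof -
  have row: "(\<Sum>y\<in>UNIV. \<pi> x * P x y * (h x - h y)\<^sup>2) =
      \<pi> x * (h x * h x) - 2 * (\<pi> x * (h x * mat_app P h x)) + \<pi> x * mat_app P (\<lambda>y. h y * h y) x" for x
  proof -
    have "(\<Sum>y\<in>UNIV. \<pi> x * P x y * (h x - h y)\<^sup>2) = (\<Sum>y\<in>UNIV. P x y * (\<pi> x * (h x * h x))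
        - 2 * (\<pi> x * (h x * (P x y * h y))) + \<pi> x * (P x y * (h y * h y)))"
      by (rule sum.cong) (auto simp: power2_eq_square algebra_simps)
    also have "\<dots> = (\<Sum>y\<in>UNIV. P x y) * (\<pi> x * (h x * h x))
        - 2 * (\<pi> x * (h x * mat_app P h x)) + \<pi> x * mat_app P (\<lambda>y. h y * h y) x"
      by (simp only: sum.distrib sum_subtractf mat_app_def sum_distrib_left sum_distrib_right)
    finally show ?thesis by (simp add: P_row_sum)
  qed
  have "(\<Sum>x\<in>UNIV. \<Sum>y\<in>UNIV. \<pi> x * P x y * (h x - h y)\<^sup>2) = mean \<pi> (\<lambda>x. h x * h x)
      - 2 * mean \<pi> (\<lambda>x. h x * mat_app P h x) + mean \<pi> (mat_app P (\<lambda>y. h y * h y))"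
    by (simp only: row mean_def sum.distrib sum_subtractf sum_distrib_left)
  then show ?thesis by (simp add: mean_mat_app dirichlet_eq)
qed

lemma dirichlet_nonneg: "0 \<le> dirichlet h h"
proof -
  have "0 \<le> (\<Sum>x\<in>UNIV. \<Sum>y\<in>UNIV. \<pi> x * P x y * (h x - h y)\<^sup>2)"
    by (intro sum_nonneg mult_nonneg_nonneg P_nonneg less_imp_le[OF weight_pos] zero_le_power2)
  then show ?thesis using dirichlet_self[of h] by linarith
qed

text \<open>Each nonnegative summand of \<open>dirichlet_self\<close> vanishes, so \<open>h\<close>
  agrees across every positive transition; irreducibility connects all states.\<close>

lemma dirichlet_zero_imp_const:
  assumes "dirichlet h h = 0"
  shows "h x = h y"
proof -
  have term_nonneg: "0 \<le> \<pi> u * P u v * (h u - h v)\<^sup>2" for u v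
    by (intro mult_nonneg_nonneg P_nonneg less_imp_le[OF weight_pos] zero_le_power2)
  have "(\<Sum>u\<in>UNIV. \<Sum>v\<in>UNIV. \<pi> u * P u v * (h u - h v)\<^sup>2) = 0"
    using dirichlet_self[of h] assms by simp
  then have zero: "\<pi> u * P u v * (h u - h v)\<^sup>2 = 0" for u v
    using term_nonneg by (simp only: sum_nonneg_eq_0_iff sum_nonneg finite UNIV_I ball_UNIV)
  have step: "h u = h v" if "P u v > 0" for u v
    using zero[of u v] that weight_pos[of u] by auto
  obtain n where pow: "mat_pow P n x y > 0"
    using irreducible unfolding irreducible_matrix_def by meson
  show ?thesis
    by (rule mat_pow_pos_imp_eq[where P = P and h = h and n = n]) (fact P_nonneg step pow)+
qed

lemma harmonic_imp_const:
  assumes "\<And>x. mat_app P h x = h x"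
  shows "h x = h y"
  by (rule dirichlet_zero_imp_const) (simp add: dirichlet_def assms mean_def)

section \<open>Poisson equation and asymptotic variance\<close>

text \<open>
  The linear map \<open>F \<mapsto> F - PF + \<langle>\<pi>, F\<rangle>\<close> is injective, hence onto. Preimages of centred functions are
  centred, so they solve the Poisson equation.
\<close>

lemma poisson_equation_exists: "\<exists>F. poisson_equation \<pi> P f F"
proof -
  define T :: "real ^ 'a \<Rightarrow> real ^ 'a" where
    "T v = (\<chi> x. v $ x - mat_app P (($) v) x + mean \<pi> (($) v))" for v
  have T_nth: "T v $ x = v $ x - mat_app P (($) v) x + mean \<pi> (($) v)" for v x
    by (simp add: T_def)
  have mean_T: "mean \<pi> (($) (T v)) = mean \<pi> (($) v)" for v
  proof -
    have "($) (T v) = (\<lambda>x. v $ x - mat_app P (($) v) x + mean \<pi> (($) v))"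
      by (simp add: T_def fun_eq_iff)
    then show ?thesis by (simp only: mean_add mean_diff mean_mat_app mean_const)
  qed
  have nth_add: "($) (u + v) = (\<lambda>x. u $ x + v $ x)"
    and nth_scale: "($) (c *\<^sub>R u) = (\<lambda>x. c * u $ x)" for u v :: "real ^ 'a" and c
    by (simp_all add: fun_eq_iff)
  have "linear T"
    by (rule linearI; unfold vec_eq_iff T_nth nth_add nth_scale)
      (simp_all add: T_nth mat_app_add mat_app_cmult mean_add mean_cmult algebra_simps)
  moreover have "inj T"
  proof -
    \<comment> \<open>\<open>T\<close> preserves means, so \<open>v\<close> is centred and the
      equation reduces to harmonicity; a constant of mean zero is zero.\<close>
    have "v = 0" if "T v = 0" for v
    proof -
      have m: "mean \<pi> (($) v) = 0"
        using mean_T[of v] that by (simp add: mean_def)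
      then have "mat_app P (($) v) x = v $ x" for x
        using T_nth[of v x] that by simp
      then have "v $ x = v $ y" for x y
        by (rule harmonic_imp_const)
      then have "($) v = (\<lambda>x. v $ y)" for y by blast
      then have "v $ y = 0" for y
        using m mean_const[of "v $ y"] by simp
      then show "v = 0" by (simp add: vec_eq_iff)
    qed
    then show ?thesis using \<open>linear T\<close> by (simp add: linear_injective_0)
  qed
  ultimately have "surj T"
    by (simp add: linear_injective_imp_surjective)
  then obtain v where v: "T v = (\<chi> x. f x - mean \<pi> f)"
    by (metis surjD)
  then have "($) (T v) = (\<lambda>x. f x - mean \<pi> f)"
    by (simp add: fun_eq_iff)
  then have "mean \<pi> (($) v) = 0"
    using mean_T[of v] by (simp add: mean_diff mean_const)
  then have "poisson_equation \<pi> P f (($) v)"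
    using v by (simp add: poisson_equation_def vec_eq_iff T_nth)
  then show ?thesis by blast
qed

lemma poisson_solution:
  "poisson_solution \<pi> P f x - mat_app P (poisson_solution \<pi> P f) x = f x - mean \<pi> f"
  using someI_ex[OF poisson_equation_exists[of f]]
  by (simp add: poisson_solution_def poisson_equation_def)

lemma dirichlet_poisson_solution: "dirichlet g (poisson_solution \<pi> P f) = covar g f"
proof -
  have "dirichlet g (poisson_solution \<pi> P f) = mean \<pi> (\<lambda>x. g x * f x - mean \<pi> f * g x)"
    by (simp add: dirichlet_def poisson_solution algebra_simps)
  then show ?thesis by (simp add: mean_diff mean_cmult covar_def)
qed

lemma covar_cmult_left: "covar (\<lambda>x. c * g x) h = c * covar g h"
  by (simp add: covar_def mult.assoc mean_cmult right_diff_distrib)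

lemma covar_self_centred: "covar f f = mean \<pi> (\<lambda>x. (f x - mean \<pi> f) * (f x - mean \<pi> f))"
proof -
  have "mean \<pi> (\<lambda>x. (f x - mean \<pi> f) * (f x - mean \<pi> f))
      = mean \<pi> (\<lambda>x. f x * f x - 2 * mean \<pi> f * f x + mean \<pi> f * mean \<pi> f)"
    by (simp add: algebra_simps)
  then show ?thesis
    by (simp only: mean_add mean_diff mean_cmult mean_const covar_def)
qed

text \<open>The gap between variance and Dirichlet form is the quadratic form of \<open>P\<close> at
  the centred \<open>f\<close>, so positivity of \<open>P\<close> compares the two.\<close>

lemma covar_self_eq:
  "covar f f = dirichlet f f + mean \<pi> (\<lambda>x. (f x - mean \<pi> f) * mat_app P (\<lambda>x. f x - mean \<pi> f) x)"
  using dirichlet_eq[of "\<lambda>x. f x - mean \<pi> f" "\<lambda>x. f x - mean \<pi> f"]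
  by (simp add: dirichlet_diff_const covar_self_centred)

text \<open>The centred \<open>f\<close> itself solves the Poisson equation, so \<open>F\<close>
  differs from it by a harmonic function, hence by a constant \<open>c\<close>. Then
  \<open>PF = c\<close>, and \<open>c\<^sup>2\<close> cancels in the variance.\<close>

lemma asymp_var_annihilated:
  assumes annihilated: "\<And>x. mat_app P (\<lambda>x. f x - mean \<pi> f) x = 0"
  shows "asymp_var \<pi> P f = covar f f"
proof -
  define F where "F = poisson_solution \<pi> P f"
  define h where "h = (\<lambda>x. F x - (f x - mean \<pi> f))"
  have "mat_app P h x = mat_app P F x - mat_app P (\<lambda>x. f x - mean \<pi> f) x" for x
    unfolding h_def by (rule mat_app_diff)
  then have "mat_app P h x = h x" for x
    using poisson_solution[of f x] annihilated[of x] by (simp add: h_def F_def)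
  then have "h x = h y" for x y by (rule harmonic_imp_const)
  then obtain c where c: "\<And>x. h x = c" by metis
  have F: "F x = (f x - mean \<pi> f) + c" for x
    using c[of x] by (simp add: h_def)
  have PF: "mat_app P F x = c" for x
    using poisson_solution[of f x] F[of x] by (simp add: F_def)
  have "mean \<pi> (\<lambda>x. (F x)\<^sup>2) = mean \<pi> (\<lambda>x. (f x - mean \<pi> f) * (f x - mean \<pi> f)
      + (2 * c) * (f x - mean \<pi> f) + c\<^sup>2)"
    by (simp add: F power2_eq_square algebra_simps)
  also have "\<dots> = covar f f + c\<^sup>2"
    by (simp only: mean_add mean_cmult mean_diff mean_const covar_self_centred) simp
  finally show ?thesis
    unfolding asymp_var_def Let_def F_def[symmetric] by (simp add: PF mean_const)
qed

end

section \<open>Barker selection: \<open>P\<close> as a sum over proposal sets\<close>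

locale barker_chain =
  fixes \<pi> :: "'a::finite \<Rightarrow> real"
    and Q :: "'a \<Rightarrow> 'a set \<Rightarrow> real"
    and \<kappa> :: "'a \<Rightarrow> 'a set \<Rightarrow> 'a \<Rightarrow> real"
    and P :: "'a \<Rightarrow> 'a \<Rightarrow> real"
  assumes weights: "prob_weights \<pi>"
    and weight_pos: "\<pi> x > 0"
    and proposal: "proposal_kernel Q"
    and selection: "x \<in> A \<Longrightarrow> y \<in> A \<Longrightarrow> \<kappa> x A y = barker \<pi> Q A y"
    and P_def: "P = transition Q \<kappa>"
    and irreducible: "irreducible_matrix P"
begin

text \<open>Divided by \<open>proposal_mass A\<close>, this is the mean of \<open>g\<close> under
  the Barker law on a set \<open>A\<close> of positive mass. Summing over all states, harmless since
  \<open>Q x A = 0\<close> off \<open>A\<close>, lets sums over states and sets be swapped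
  freely.\<close>

definition proposal_sum :: "'a set \<Rightarrow> ('a \<Rightarrow> real) \<Rightarrow> real" where
  "proposal_sum A g = (\<Sum>x\<in>UNIV. \<pi> x * Q x A * g x)"

abbreviation proposal_mass :: "'a set \<Rightarrow> real" where
  "proposal_mass A \<equiv> proposal_sum A (\<lambda>x. 1)"

lemma Q_nonneg: "0 \<le> Q x A"
  and Q_eq_0: "x \<notin> A \<Longrightarrow> Q x A = 0"
  and Q_sum: "(\<Sum>A\<in>UNIV. Q x A) = 1"
  using proposal by (auto simp: proposal_kernel_def)

lemma proposal_sum_on: "(\<Sum>x\<in>A. \<pi> x * Q x A * g x) = proposal_sum A g"
  unfolding proposal_sum_def by (rule sum.mono_neutral_left) (auto simp: Q_eq_0)

lemma proposal_mass_nonneg: "0 \<le> proposal_mass A"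
  by (auto simp: proposal_sum_def intro!: sum_nonneg mult_nonneg_nonneg Q_nonneg less_imp_le[OF weight_pos])

lemma proposal_mass_zero:
  assumes "proposal_mass A = 0"
  shows "Q x A = 0"
proof -
  have "\<forall>x\<in>UNIV. \<pi> x * Q x A = 0"
    using assms Q_nonneg less_imp_le[OF weight_pos]
    by (subst sum_nonneg_eq_0_iff[symmetric]) (auto simp: proposal_sum_def)
  then show ?thesis using weight_pos[of x] by (metis UNIV_I less_irrefl mult_eq_0_iff)
qed

text \<open>Both sides vanish on the sets that are never proposed, the right one because \<open>t / 0 = 0\<close>.\<close>

lemma Q_mult_selection:
  assumes "y \<in> A"
  shows "Q x A * \<kappa> x A y = Q x A * (\<pi> y * Q y A / proposal_mass A)"
proof (cases "x \<in> A \<and> proposal_mass A \<noteq> 0")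
  case True
  then show ?thesis
    using assms selection[of x A y] proposal_sum_on[of A "\<lambda>x. 1"] by (simp add: barker_def)
next
  case False
  then have "Q x A = 0" using Q_eq_0 proposal_mass_zero by blast
  then show ?thesis by simp
qed

text \<open>Multiplied by \<open>\<pi> x\<close>, each summand is symmetric in \<open>x\<close> and
  \<open>y\<close>, which gives reversibility.\<close>

lemma P_eq: "P x y = (\<Sum>A\<in>UNIV. Q x A * (\<pi> y * Q y A / proposal_mass A))"
proof -
  have "P x y = (\<Sum>A\<in>{A. x \<in> A \<and> y \<in> A}. Q x A * (\<pi> y * Q y A / proposal_mass A))"
    unfolding P_def transition_def by (rule sum.cong) (auto simp: Q_mult_selection)
  also have "\<dots> = (\<Sum>A\<in>UNIV. Q x A * (\<pi> y * Q y A / proposal_mass A))"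
    by (rule sum.mono_neutral_left) (use Q_eq_0 in \<open>force+\<close>)
  finally show ?thesis .
qed

lemma mat_app_eq: "mat_app P h x = (\<Sum>A\<in>UNIV. Q x A * (proposal_sum A h / proposal_mass A))"
proof -
  have "mat_app P h x = (\<Sum>y\<in>UNIV. \<Sum>A\<in>UNIV. Q x A / proposal_mass A * (\<pi> y * Q y A * h y))"
    by (simp only: mat_app_def P_eq sum_distrib_right) (simp add: mult_ac)
  also have "\<dots> = (\<Sum>A\<in>UNIV. Q x A / proposal_mass A * proposal_sum A h)"
    by (subst sum.swap) (simp add: proposal_sum_def sum_distrib_left)
  finally show ?thesis by simp
qed

text \<open>\<open>P\<close> averages over \<open>A\<close> and then redistributes, so the form
  splits over the sets; for \<open>g = h\<close> every term is a square over a nonnegative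
  mass.\<close>

lemma mean_mult_mat_app:
  "mean \<pi> (\<lambda>x. g x * mat_app P h x)
    = (\<Sum>A\<in>UNIV. proposal_sum A g * proposal_sum A h / proposal_mass A)"
proof -
  have "mean \<pi> (\<lambda>x. g x * mat_app P h x)
      = (\<Sum>x\<in>UNIV. \<Sum>A\<in>UNIV. (\<pi> x * Q x A * g x) * (proposal_sum A h / proposal_mass A))"
    by (simp add: mean_def mat_app_eq sum_distrib_left algebra_simps)
  also have "\<dots> = (\<Sum>A\<in>UNIV. proposal_sum A g * (proposal_sum A h / proposal_mass A))"
    by (subst sum.swap) (simp only: proposal_sum_def[of _ g] sum_distrib_right)
  finally show ?thesis by simp
qed

sublocale reversible_chain \<pi> P
proof
  show "(\<Sum>x\<in>UNIV. \<pi> x) = 1" using weights by (simp add: prob_weights_def)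
  show "0 \<le> P x y" for x y
    unfolding P_eq
    by (intro sum_nonneg mult_nonneg_nonneg divide_nonneg_nonneg Q_nonneg proposal_mass_nonneg
        less_imp_le[OF weight_pos])
  show "(\<Sum>y\<in>UNIV. P x y) = 1" for x
  proof -
    have "(\<Sum>y\<in>UNIV. P x y) = mat_app P (\<lambda>y. 1) x" by (simp add: mat_app_def)
    also have "\<dots> = (\<Sum>A\<in>UNIV. Q x A)"
      \<comment> \<open>The ratio of masses is 1, or \<open>0 / 0 = 0\<close> on a set where
        \<open>Q x A = 0\<close> anyway.\<close>
      unfolding mat_app_eq by (rule sum.cong) (auto simp: proposal_mass_zero)
    finally show ?thesis by (simp add: Q_sum)
  qed
  show "\<pi> x * P x y = \<pi> y * P y x" for x y
    by (simp add: P_eq sum_distrib_left algebra_simps)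
qed (rule weight_pos irreducible)+

lemma mean_mat_app_nonneg: "0 \<le> mean \<pi> (\<lambda>x. g x * mat_app P g x)"
  unfolding mean_mult_mat_app
  by (auto intro!: sum_nonneg divide_nonneg_nonneg proposal_mass_nonneg)

text \<open>A vanishing sum of squares kills every ratio
  \<open>proposal_sum A g / proposal_mass A\<close>, and \<open>Pg\<close> is a combination of these
  ratios.\<close>

lemma mat_app_eq_0:
  assumes "mean \<pi> (\<lambda>x. g x * mat_app P g x) = 0"
  shows "mat_app P g x = 0"
proof -
  have "proposal_sum A g * proposal_sum A g / proposal_mass A = 0" for A
    using assms unfolding mean_mult_mat_app
    by (subst (asm) sum_nonneg_eq_0_iff) (auto intro!: divide_nonneg_nonneg proposal_mass_nonneg)
  then have "proposal_sum A g / proposal_mass A = 0" for A by auto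
  then show ?thesis by (simp only: mat_app_eq mult_zero_right sum.neutral_const)
qed

lemma expected_selection_variance:
  "(\<Sum>x\<in>UNIV. \<Sum>A\<in>UNIV. \<pi> x * Q x A * var_on A (\<kappa> x A) g) = dirichlet g g"
proof -
  \<comment> \<open>\<open>V A\<close> is the selection variance freed from \<open>x\<close>. It may
    differ from \<open>var_on\<close> only where \<open>Q x A = 0\<close>, and there the weight
    removes both.\<close>
  define V where "V A = proposal_sum A (\<lambda>y. (g y)\<^sup>2) / proposal_mass A
    - (proposal_sum A g / proposal_mass A)\<^sup>2" for A
  have V: "Q x A * var_on A (\<kappa> x A) g = Q x A * V A" for x A
  proof (cases "Q x A = 0")
    case False
    have \<kappa>: "\<kappa> x A y = \<pi> y * Q y A / proposal_mass A" if "y \<in> A" for y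
      using Q_mult_selection[OF that, of x] False by (simp only: mult_cancel_left simp_thms)
    have "(\<Sum>y\<in>A. \<kappa> x A y * u y) = proposal_sum A u / proposal_mass A" for u
    proof -
      have "(\<Sum>y\<in>A. \<kappa> x A y * u y) = (\<Sum>y\<in>A. \<pi> y * Q y A * u y) / proposal_mass A"
        unfolding sum_divide_distrib by (rule sum.cong) (auto simp: \<kappa>)
      then show ?thesis by (simp only: proposal_sum_on)
    qed
    then show ?thesis by (simp add: var_on_def V_def)
  qed simp
  have mass_V: "proposal_mass A * V A = proposal_sum A (\<lambda>y. (g y)\<^sup>2)
      - proposal_sum A g * proposal_sum A g / proposal_mass A" for A
  proof (cases "proposal_mass A = 0")
    \<comment> \<open>With zero mass the left side is 0, so the second moment must vanish too: every
      \<open>Q x A\<close> is 0.\<close>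
    case True
    then have "proposal_sum A (\<lambda>y. (g y)\<^sup>2) = 0"
      using proposal_mass_zero by (simp add: proposal_sum_def)
    then show ?thesis using True by simp
  qed (simp add: V_def field_simps power2_eq_square)
  have "(\<Sum>x\<in>UNIV. \<Sum>A\<in>UNIV. \<pi> x * Q x A * var_on A (\<kappa> x A) g)
      = (\<Sum>x\<in>UNIV. \<Sum>A\<in>UNIV. \<pi> x * Q x A * V A)"
    by (simp only: mult.assoc V)
  also have "\<dots> = (\<Sum>A\<in>UNIV. proposal_mass A * V A)"
    by (subst sum.swap) (simp add: proposal_sum_def sum_distrib_right)
  also have "\<dots> = (\<Sum>A\<in>UNIV. proposal_sum A (\<lambda>y. (g y)\<^sup>2)) - mean \<pi> (\<lambda>x. g x * mat_app P g x)"
    by (simp only: mass_V sum_subtractf mean_mult_mat_app)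
  \<comment> \<open>Since \<open>Q y\<close> has total mass 1, the second moments add up to the one
    under \<open>\<pi>\<close>.\<close>
  also have "(\<Sum>A\<in>UNIV. proposal_sum A (\<lambda>y. (g y)\<^sup>2))
      = (\<Sum>y\<in>UNIV. (\<Sum>A\<in>UNIV. Q y A) * (\<pi> y * (g y * g y)))"
    unfolding proposal_sum_def
    by (subst sum.swap) (simp add: sum_distrib_left power2_eq_square algebra_simps)
  also have "\<dots> = mean \<pi> (\<lambda>x. g x * g x)"
    by (simp add: Q_sum mean_def)
  finally show ?thesis by (simp add: dirichlet_eq)
qed

section \<open>Control variates and the optimal coefficient\<close>

text \<open>The correction is a difference of two Dirichlet forms in which the energy of
  \<open>F\<close> cancels; only the cross term with \<open>\<psi>\<close> remains, and it is a
  covariance.\<close>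

lemma asymp_var_control_eq:
  "asymp_var_control \<pi> Q \<kappa> f \<psi> = asymp_var \<pi> P f + dirichlet \<psi> \<psi> - 2 * covar \<psi> f"
proof -
  define F where "F = poisson_solution \<pi> P f"
  have "asymp_var_control \<pi> Q \<kappa> f \<psi>
      = asymp_var \<pi> P f + (dirichlet (\<lambda>y. \<psi> y - F y) (\<lambda>y. \<psi> y - F y) - dirichlet F F)"
    unfolding asymp_var_control_def Let_def P_def[symmetric] F_def[symmetric]
      expected_selection_variance[symmetric]
    by (simp only: right_diff_distrib sum_subtractf)
  then show ?thesis
    using dirichlet_poisson_solution[of \<psi> f] by (simp add: dirichlet_diff F_def)
qed

lemma dirichlet_le_covar: "dirichlet f f \<le> covar f f"
  using covar_self_eq[of f] mean_mat_app_nonneg[of "\<lambda>x. f x - mean \<pi> f"] by simp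

lemma dirichlet_less_covar:
  assumes "asymp_var_control \<pi> Q \<kappa> f f > 0"
  shows "dirichlet f f < covar f f"
proof (rule ccontr)
  assume "\<not> ?thesis"
  then have eq: "dirichlet f f = covar f f"
    using dirichlet_le_covar[of f] by simp
  then have "asymp_var \<pi> P f = covar f f"
    using covar_self_eq[of f] by (intro asymp_var_annihilated mat_app_eq_0) simp
  \<comment> \<open>With \<open>V\<close> the common value of the three terms, the controlled
    variance is \<open>V + V - 2 * V = 0\<close>.\<close>
  then show False using assms eq by (simp add: asymp_var_control_eq)
qed

end

theorem proposition2p8:
  fixes \<pi> :: "'a::finite \<Rightarrow> real"
    and Q :: "'a \<Rightarrow> 'a set \<Rightarrow> real"
    and \<kappa> :: "'a \<Rightarrow> 'a set \<Rightarrow> 'a \<Rightarrow> real"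
    and P :: "'a \<Rightarrow> 'a \<Rightarrow> real"
    and f :: "'a \<Rightarrow> real"
    and b_star :: real
  assumes "prob_weights \<pi>"
    and "\<And>x. \<pi> x > 0"
    and "proposal_kernel Q"
    and "\<And>A x y. x \<in> A \<Longrightarrow> y \<in> A \<Longrightarrow> \<kappa> x A y = barker \<pi> Q A y"
    and "P = transition Q \<kappa>"
    and "irreducible_matrix P"
    and "b_star = (mean \<pi> (\<lambda>x. (f x)^2) - (mean \<pi> f)^2) /
                  mean \<pi> (\<lambda>x. (f x)^2 - f x * mat_app P f x)"
  shows "asymp_var_control \<pi> Q \<kappa> f f \<le> asymp_var \<pi> P f \<and>
         ((\<nexists>c. \<forall>x. f x = c) \<longrightarrow>
            mean \<pi> (\<lambda>x. (f x)^2 - f x * mat_app P f x) \<noteq> 0 \<and>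
            (\<forall>b. asymp_var_control \<pi> Q \<kappa> f (\<lambda>x. b_star * f x)
                   \<le> asymp_var_control \<pi> Q \<kappa> f (\<lambda>x. b * f x)) \<and>
            (asymp_var_control \<pi> Q \<kappa> f f > 0 \<longrightarrow> b_star > 1))"
proof -
  interpret barker_chain \<pi> Q \<kappa> P
    using assms by unfold_locales
  have D: "mean \<pi> (\<lambda>x. (f x)^2 - f x * mat_app P f x) = dirichlet f f"
    by (simp add: dirichlet_def power2_eq_square algebra_simps)
  have C: "mean \<pi> (\<lambda>x. (f x)^2) - (mean \<pi> f)^2 = covar f f"
    by (simp add: covar_def power2_eq_square)
  have b: "b_star = covar f f / dirichlet f f"
    using assms(7) unfolding D C .
  have "asymp_var_control \<pi> Q \<kappa> f f \<le> asymp_var \<pi> P f"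
    \<comment> \<open>From \<open>0 \<le> D \<le> C\<close> follows
      \<open>D - 2 * C \<le> 0\<close>, where \<open>D\<close> is the Dirichlet form and
      \<open>C\<close> the variance of \<open>f\<close>.\<close>
    using dirichlet_le_covar[of f] dirichlet_nonneg[of f] by (simp add: asymp_var_control_eq)
  moreover have "mean \<pi> (\<lambda>x. (f x)^2 - f x * mat_app P f x) \<noteq> 0 \<and>
      (\<forall>b. asymp_var_control \<pi> Q \<kappa> f (\<lambda>x. b_star * f x)
             \<le> asymp_var_control \<pi> Q \<kappa> f (\<lambda>x. b * f x)) \<and>
      (asymp_var_control \<pi> Q \<kappa> f f > 0 \<longrightarrow> b_star > 1)"
    if "\<nexists>c. \<forall>x. f x = c"
  proof -
    have pos: "dirichlet f f > 0"
      using that dirichlet_zero_imp_const[of f] dirichlet_nonneg[of f] by (metis less_le)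
    \<comment> \<open>Completing the square: the linear coefficient is
      \<open>-2 * covar f f\<close>, and the covariance is \<open>b_star\<close> times the Dirichlet
      form.\<close>
    have control: "asymp_var_control \<pi> Q \<kappa> f (\<lambda>x. b * f x)
        = asymp_var_control \<pi> Q \<kappa> f (\<lambda>x. b_star * f x) + dirichlet f f * (b - b_star)\<^sup>2" for b
    proof -
      have "covar f f = b_star * dirichlet f f" using b pos by simp
      then show ?thesis
        by (simp add: asymp_var_control_eq dirichlet_cmult covar_cmult_left power2_eq_square
            algebra_simps)
    qed
    have "asymp_var_control \<pi> Q \<kappa> f (\<lambda>x. b_star * f x) \<le> asymp_var_control \<pi> Q \<kappa> f (\<lambda>x. b * f x)" for b
      using control[of b] pos by simp
    moreover have "b_star > 1" if "asymp_var_control \<pi> Q \<kappa> f f > 0"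
      using dirichlet_less_covar[OF that] pos b by simp
    ultimately show ?thesis using pos D by simp
  qed
  ultimately show ?thesis by blast
qed

end
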